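(* Let $\widetilde{\mathrm{E}_0}(2)$ be the universal covering group of the connected component $\mathrm{E}_0(2)$ of the Euclidean group of the plane, and let $\mathbb{B}_0=(X_1,X_2,X_3)$ be the basis of its Lie algebra with $[X_1,X_2]=X_3$, $[X_1,X_3]=-X_2$, $[X_2,X_3]=0$. Then any Lorentzian left invariant metric on $\widetilde{\mathrm{E}_0}(2)$ is isometric, via an automorphism, to a left invariant metric whose matrix in $\mathbb{B}_0$ is of one of the following three forms: $$\begin{pmatrix}0&1&0\\1&u&0\\0&0&v\end{pmatrix}\ (u>0,v>0),\qquad\begin{pmatrix}0&-1&0\\-1&-u&0\\0&0&v\end{pmatrix}\ (u>0,v>0),\qquad\begin{pmatrix}0&1&0\\1&0&0\\0&0&u\end{pmatrix}\ (u>0).$$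
   Context: A Lorentzian left invariant metric $h$ on a three dimensional Lie group $G$ is identified with a nondegenerate symmetric bilinear form of signature $(+,+,-)$ on the Lie algebra $\mathfrak{g}$; its matrix in a basis $\mathbb{B}_0$ is the Gram matrix of this form. Two left invariant metrics $h_1,h_2$ on $G$ are isometric via an automorphism if there is a Lie group automorphism $\phi$ of $G$ with $h_1=\phi^*h_2$; since $G$ is simply connected, this is equivalent to the existence of a Lie algebra automorphism of $\mathfrak{g}$ pulling back one form to the other. *)

theory Defs
  imports "HOL-Analysis.Analysis" "HOL-Algebra.Group"
begin

section \<open>Lie groups with one global chart\<close>

text \<open>
  The manifold underlying the universal covering group of the connected Euclidean group
  of the plane is diffeomorphic to a Euclidean space. A Lie group is therefore represented
  here by a group whose carrier is a whole Euclidean space, with the identity as global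
  chart; every tangent space is identified with that Euclidean space.
\<close>

text \<open>
  On a finite-dimensional domain, the next notion is that of a map of class \<open>C\<^sup>k\<close>: all
  iterated directional derivatives up to order \<open>k\<close> exist and are continuous.
\<close>

primrec cont_diff ::
  "nat \<Rightarrow> ('a::euclidean_space \<Rightarrow> 'b::real_normed_vector) \<Rightarrow> bool" where
  "cont_diff 0 = (\<lambda>f. continuous_on UNIV f)"
| "cont_diff (Suc k) = (\<lambda>f. (\<forall>x. f differentiable (at x)) \<and>
     (\<forall>v. cont_diff k (\<lambda>x. frechet_derivative f (at x) v)))"

definition smooth :: "('a::euclidean_space \<Rightarrow> 'b::real_normed_vector) \<Rightarrow> bool" where
  "smooth f \<longleftrightarrow> (\<forall>k. cont_diff k f)"

definition lie_group :: "'a::euclidean_space monoid \<Rightarrow> bool" where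
  "lie_group G \<longleftrightarrow> group G \<and> carrier G = UNIV \<and>
     smooth (\<lambda>(x, y). x \<otimes>\<^bsub>G\<^esub> y) \<and> smooth (\<lambda>x. inv\<^bsub>G\<^esub> x)"

definition lie_automorphisms :: "'a::euclidean_space monoid \<Rightarrow> ('a \<Rightarrow> 'a) set" where
  "lie_automorphisms G =
     {\<phi> \<in> iso G G. smooth \<phi> \<and> smooth (inv_into (carrier G) \<phi>)}"

definition left_translation_deriv ::
  "'a::euclidean_space monoid \<Rightarrow> 'a \<Rightarrow> 'a \<Rightarrow> 'a \<Rightarrow> 'a" where
  "left_translation_deriv G a p = frechet_derivative (\<lambda>x. a \<otimes>\<^bsub>G\<^esub> x) (at p)"

definition left_invariant_field ::
  "'a::euclidean_space monoid \<Rightarrow> 'a \<Rightarrow> 'a \<Rightarrow> 'a" where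
  "left_invariant_field G v p = left_translation_deriv G p \<one>\<^bsub>G\<^esub> v"

definition vector_field_bracket ::
  "('a::euclidean_space \<Rightarrow> 'a) \<Rightarrow> ('a \<Rightarrow> 'a) \<Rightarrow> 'a \<Rightarrow> 'a" where
  "vector_field_bracket V W p =
     frechet_derivative W (at p) (V p) - frechet_derivative V (at p) (W p)"

text \<open>
  The Lie algebra is the tangent space at the unit, with the bracket of the left invariant
  vector fields.
\<close>

definition lie_bracket :: "'a::euclidean_space monoid \<Rightarrow> 'a \<Rightarrow> 'a \<Rightarrow> 'a" where
  "lie_bracket G v w =
     vector_field_bracket (left_invariant_field G v) (left_invariant_field G w) \<one>\<^bsub>G\<^esub>"


section \<open>Lorentzian left invariant metrics in dimension three\<close>

definition is_basis :: "(3 \<Rightarrow> 'a::euclidean_space) \<Rightarrow> bool" where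
  "is_basis b \<longleftrightarrow> inj b \<and> independent (range b) \<and> span (range b) = UNIV"

definition gram_matrix ::
  "('a::euclidean_space \<Rightarrow> 'a \<Rightarrow> real) \<Rightarrow> (3 \<Rightarrow> 'a) \<Rightarrow> real^3^3" where
  "gram_matrix B b = (\<chi> i j. B (b i) (b j))"

definition lorentzian_form :: "('a::euclidean_space \<Rightarrow> 'a \<Rightarrow> real) \<Rightarrow> bool" where
  "lorentzian_form B \<longleftrightarrow>
     bilinear B \<and>
     (\<forall>v w. B v w = B w v) \<and>
     (\<forall>v. (\<forall>w. B v w = 0) \<longrightarrow> v = 0) \<and>
     (\<exists>b. is_basis b \<and>
        gram_matrix B b = vector [vector [1, 0, 0], vector [0, 1, 0], vector [0, 0, -1]])"

text \<open>
  A metric \<open>h\<close> assigns to a point \<open>p\<close> the form \<open>h p\<close> on the tangent space at \<open>p\<close>.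
\<close>

definition lorentzian_metric :: "('a::euclidean_space \<Rightarrow> 'a \<Rightarrow> 'a \<Rightarrow> real) \<Rightarrow> bool" where
  "lorentzian_metric h \<longleftrightarrow>
     (\<forall>p. lorentzian_form (h p)) \<and> (\<forall>v w. smooth (\<lambda>p. h p v w))"

definition left_invariant ::
  "'a::euclidean_space monoid \<Rightarrow> ('a \<Rightarrow> 'a \<Rightarrow> 'a \<Rightarrow> real) \<Rightarrow> bool" where
  "left_invariant G h \<longleftrightarrow>
     (\<forall>a p v w. h (a \<otimes>\<^bsub>G\<^esub> p) (left_translation_deriv G a p v) (left_translation_deriv G a p w)
                = h p v w)"

definition pullback ::
  "('a::euclidean_space \<Rightarrow> 'a) \<Rightarrow> ('a \<Rightarrow> 'a \<Rightarrow> 'a \<Rightarrow> real) \<Rightarrow> 'a \<Rightarrow> 'a \<Rightarrow> 'a \<Rightarrow> real" where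
  "pullback \<phi> h p v w =
     h (\<phi> p) (frechet_derivative \<phi> (at p) v) (frechet_derivative \<phi> (at p) w)"

definition isometric_via_automorphism ::
  "'a::euclidean_space monoid \<Rightarrow> ('a \<Rightarrow> 'a \<Rightarrow> 'a \<Rightarrow> real) \<Rightarrow> ('a \<Rightarrow> 'a \<Rightarrow> 'a \<Rightarrow> real) \<Rightarrow> bool" where
  "isometric_via_automorphism G h1 h2 \<longleftrightarrow> (\<exists>\<phi>\<in>lie_automorphisms G. h1 = pullback \<phi> h2)"


section \<open>The connected Euclidean group of the plane and its universal covering group\<close>

text \<open>
  The plane is the set of complex numbers; the pair \<open>(w, b)\<close> with \<open>\<bar>w\<bar> = 1\<close> stands for the
  orientation preserving rigid motion \<open>z \<mapsto> w z + b\<close>.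
\<close>

definition rigid_motion :: "complex \<times> complex \<Rightarrow> complex \<Rightarrow> complex" where
  "rigid_motion = (\<lambda>(w, b) z. w * z + b)"

definition E0_2 :: "(complex \<times> complex) monoid" where
  "E0_2 = \<lparr>carrier = sphere 0 1 \<times> UNIV,
           mult = (\<lambda>(w, b) (w', b'). (w * w', b + w * b')),
           one = (1, 0)\<rparr>"

definition E0_2_cover :: "(real \<times> complex) monoid" where
  "E0_2_cover = \<lparr>carrier = UNIV,
                 mult = (\<lambda>(t, b) (t', b'). (t + t', b + cis t * b')),
                 one = (0, 0)\<rparr>"

definition E0_2_proj :: "real \<times> complex \<Rightarrow> complex \<times> complex" where
  "E0_2_proj = (\<lambda>(t, b). (cis t, b))"

lemma E0_2_cover_simps [simp]:
  "carrier E0_2_cover = UNIV"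
  "(t, b) \<otimes>\<^bsub>E0_2_cover\<^esub> (t', b') = (t + t', b + cis t * b')"
  "\<one>\<^bsub>E0_2_cover\<^esub> = (0, 0)"
  by (simp_all add: E0_2_cover_def)

lemma E0_2_simps [simp]:
  "carrier E0_2 = sphere 0 1 \<times> UNIV"
  "(w, b) \<otimes>\<^bsub>E0_2\<^esub> (w', b') = (w * w', b + w * b')"
  "\<one>\<^bsub>E0_2\<^esub> = (1, 0)"
  by (simp_all add: E0_2_def)

lemma group_E0_2: "group E0_2"
proof (rule groupI)
  fix x assume "x \<in> carrier E0_2"
  then obtain w b where x: "x = (w, b)" "cmod w = 1" by auto
  then have "inverse w * w = 1" by (metis left_inverse norm_zero zero_neq_one)
  then have "(inverse w, - inverse w * b) \<otimes>\<^bsub>E0_2\<^esub> x = \<one>\<^bsub>E0_2\<^esub>"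
    using x by simp
  moreover have "(inverse w, - inverse w * b) \<in> carrier E0_2"
    using x by (simp add: norm_inverse)
  ultimately show "\<exists>y\<in>carrier E0_2. y \<otimes>\<^bsub>E0_2\<^esub> x = \<one>\<^bsub>E0_2\<^esub>" by blast
qed (auto simp: norm_mult algebra_simps)

lemma rigid_motion_mult:
  "rigid_motion (x \<otimes>\<^bsub>E0_2\<^esub> y) = rigid_motion x \<circ> rigid_motion y"
  by (cases x; cases y) (auto simp: rigid_motion_def algebra_simps)

lemma group_E0_2_cover: "group E0_2_cover"
proof (rule groupI)
  fix x assume "x \<in> carrier E0_2_cover"
  obtain t b where x: "x = (t, b)" by (cases x)
  have "(- t, - cis (- t) * b) \<otimes>\<^bsub>E0_2_cover\<^esub> x = \<one>\<^bsub>E0_2_cover\<^esub>"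
    by (simp add: x)
  then show "\<exists>y\<in>carrier E0_2_cover. y \<otimes>\<^bsub>E0_2_cover\<^esub> x = \<one>\<^bsub>E0_2_cover\<^esub>" by auto
qed (auto simp: algebra_simps simp flip: cis_mult)

lemma E0_2_proj_hom: "E0_2_proj \<in> hom E0_2_cover E0_2"
  by (auto simp: hom_def E0_2_proj_def cis_mult)

lemma covering_space_E0_2: "covering_space (carrier E0_2_cover) E0_2_proj (carrier E0_2)"
proof -
  have cont: "continuous_on UNIV E0_2_proj"
    unfolding E0_2_proj_def case_prod_beta by (intro continuous_intros continuous_on_cis)
  have surj: "range E0_2_proj = sphere 0 1 \<times> UNIV"
  proof -
    have "(w, b) \<in> range E0_2_proj" if "cmod w = 1" for w b
    proof -
      have "w = cis (Arg w)" using that cis_Arg[of w] by (force simp: sgn_div_norm)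
      then have "(w, b) = E0_2_proj (Arg w, b)" by (simp add: E0_2_proj_def)
      then show ?thesis by blast
    qed
    then show ?thesis by (auto simp: E0_2_proj_def)
  qed
  have loc: "\<exists>T. x \<in> T \<and> openin (top_of_set (sphere 0 1 \<times> UNIV)) T \<and>
      (\<exists>v. \<Union>v = E0_2_proj -` T \<and> (\<forall>u\<in>v. open u) \<and> pairwise disjnt v \<and>
           (\<forall>u\<in>v. \<exists>q. homeomorphism u T E0_2_proj q))"
    if "x \<in> sphere 0 1 \<times> (UNIV :: complex set)" for x
  proof -
    have "x \<in> range E0_2_proj" using that by (simp only: surj)
    then obtain y where "x = E0_2_proj y" by blast
    then obtain a b0 where x: "x = (cis a, b0)"
      by (cases y) (simp add: E0_2_proj_def)
    define T :: "(complex \<times> complex) set"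
      where "T = (sphere 0 1 \<times> UNIV) \<inter> {y. 0 < Re (fst y * cis (- a))}"
    define c where "c n = a + 2 * pi * of_int n" for n :: int
    define V where "V n = {c n - pi/2 <..< c n + pi/2} \<times> (UNIV :: complex set)" for n
    define q where "q n y = (c n + Im (Ln (fst y * cis (- a))), snd y)"
      for n and y :: "complex \<times> complex"
    have cisc: "cis (c n) = cis a" for n
      by (simp add: c_def complex_eq_iff cos_add sin_add)
    have "x \<in> T" by (simp add: x T_def cis_mult)
    moreover have "openin (top_of_set (sphere 0 1 \<times> UNIV)) T"
      unfolding T_def
      by (intro openin_open_Int open_Collect_less continuous_intros)
    moreover have "\<Union>(range V) = E0_2_proj -` T"
    proof -
      have eq: "(t, b) \<in> E0_2_proj -` T \<longleftrightarrow> 0 < cos (t - a)" for t b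
        by (simp add: E0_2_proj_def T_def cos_diff)
      have "0 < cos (t - a)" if "(t, b) \<in> V n" for t b n
      proof -
        have "cos (t - a) = cos (t - c n)"
          using cos_diff[of "t - a" "2 * pi * of_int n"] by (simp add: c_def diff_diff_eq)
        then show ?thesis using that by (auto simp: V_def intro!: cos_gt_zero_pi)
      qed
      moreover have "\<exists>n. (t, b) \<in> V n" if pos: "0 < cos (t - a)" for t b
      proof -
        define n where "n = round ((t - a) / (2 * pi))"
        define s where "s = t - c n"
        have "\<bar>of_int n - (t - a) / (2 * pi)\<bar> \<le> 1/2"
          unfolding n_def by (rule of_int_round_abs_le)
        then have "\<bar>(of_int n - (t - a) / (2 * pi)) * (2 * pi)\<bar> \<le> 1/2 * (2 * pi)"
          unfolding abs_mult by (intro mult_mono) auto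
        moreover have "(of_int n - (t - a) / (2 * pi)) * (2 * pi) = - s"
          by (simp add: s_def c_def field_simps)
        ultimately have s: "\<bar>s\<bar> \<le> pi" by simp
        have "cos (t - a) = cos s"
          using cos_diff[of "t - a" "2 * pi * of_int n"] by (simp add: s_def c_def diff_diff_eq)
        then have p: "0 < cos \<bar>s\<bar>" using pos by simp
        have "\<bar>s\<bar> < pi/2"
        proof (rule ccontr)
          assume "\<not> \<bar>s\<bar> < pi/2"
          then have "cos \<bar>s\<bar> \<le> cos (pi/2)" using s by (intro cos_monotone_0_pi_le) auto
          then show False using p by simp
        qed
        then have "- (pi/2) < t - c n" "t - c n < pi/2" unfolding s_def by linarith+
        then have "(t, b) \<in> V n" by (simp add: V_def algebra_simps)
        then show ?thesis ..
      qed
      ultimately have "(t, b) \<in> \<Union>(range V) \<longleftrightarrow> (t, b) \<in> E0_2_proj -` T" for t b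
        unfolding eq by (metis UN_iff UNIV_I)
      then show ?thesis by (simp only: set_eq_iff split_paired_All) simp
    qed
    moreover have "\<forall>u\<in>range V. open u"
      by (auto simp: V_def intro!: open_Times)
    moreover have "pairwise disjnt (range V)"
    proof -
      have "m = n" if "(t, b) \<in> V m" "(t, b) \<in> V n" for t b m n
      proof -
        have less: "\<bar>c m - c n\<bar> < pi" using that unfolding V_def by auto
        have "c m - c n = 2 * pi * of_int (m - n)"
          by (simp add: c_def algebra_simps)
        then have eq: "\<bar>c m - c n\<bar> = 2 * pi * \<bar>of_int (m - n)\<bar>"
          by (simp only: abs_mult) simp
        show ?thesis
        proof (rule ccontr)
          assume "m \<noteq> n"
          then have "1 \<le> \<bar>real_of_int (m - n)\<bar>" by linarith
          then have "2 * pi * 1 \<le> 2 * pi * \<bar>real_of_int (m - n)\<bar>"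
            by (intro mult_left_mono) auto
          then show False using less eq pi_gt_zero by linarith
        qed
      qed
      then show ?thesis
        unfolding pairwise_def disjnt_iff by (metis imageE surj_pair)
    qed
    moreover have "homeomorphism (V n) T E0_2_proj (q n)" for n
    proof (rule homeomorphismI)
      show "continuous_on (V n) E0_2_proj" using cont continuous_on_subset by blast
      show "continuous_on T (q n)"
        unfolding q_def
        by (intro continuous_intros) (auto simp: T_def complex_nonpos_Reals_iff)
      show "E0_2_proj ` V n \<subseteq> T"
        using \<open>\<Union>(range V) = E0_2_proj -` T\<close> by blast
      show "q n ` T \<subseteq> V n"
      proof (rule image_subsetI)
        fix y assume "y \<in> T"
        then have "fst y * cis (- a) \<noteq> 0" "0 < Re (fst y * cis (- a))" by (auto simp: T_def)
        then have "\<bar>Im (Ln (fst y * cis (- a)))\<bar> < pi/2"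
          using Re_Ln_pos_lt by blast
        then have "- (pi/2) < Im (Ln (fst y * cis (- a)))" "Im (Ln (fst y * cis (- a))) < pi/2"
          by linarith+
        then show "q n y \<in> V n" by (simp add: q_def V_def)
      qed
      show "q n (E0_2_proj y) = y" if y: "y \<in> V n" for y
      proof -
        obtain t b where tb: "y = (t, b)" by (cases y)
        have "cis t * cis (- a) = cis (t - c n)"
        proof -
          have "cis (t - c n) = cis t / cis (c n)" by (simp add: cis_divide)
          also have "\<dots> = cis t / cis a" by (simp only: cisc)
          finally show ?thesis by (simp add: cis_divide cis_mult)
        qed
        also have "\<dots> = exp (\<i> * of_real (t - c n))" by (simp add: cis_conv_exp)
        finally have "Ln (cis t * cis (- a)) = Ln (exp (\<i> * of_real (t - c n)))" by simp
        also have "\<dots> = \<i> * of_real (t - c n)"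
          using y by (intro Ln_exp) (auto simp: V_def tb)
        finally show ?thesis by (simp add: tb q_def E0_2_proj_def)
      qed
      show "E0_2_proj (q n y) = y" if y: "y \<in> T" for y
      proof -
        obtain w b where wb: "y = (w, b)" by (cases y)
        define z where "z = w * cis (- a)"
        have z: "z \<noteq> 0" "cmod z = 1" using y by (auto simp: T_def wb z_def norm_mult)
        have "cis (Im (Ln z)) = z"
        proof -
          have "Re (Ln z) = 0" using z by simp
          then have "Ln z = \<i> * of_real (Im (Ln z))" by (simp add: complex_eq_iff)
          then have "exp (Ln z) = cis (Im (Ln z))" by (metis cis_conv_exp)
          then show ?thesis using z by simp
        qed
        then have "cis (c n + Im (Ln z)) = cis a * z" by (simp add: cisc flip: cis_mult)
        also have "\<dots> = w" by (simp add: z_def cis_mult mult.left_commute)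
        finally show ?thesis by (simp add: wb q_def E0_2_proj_def z_def)
      qed
    qed
    ultimately show ?thesis by (intro exI[of _ T] conjI exI[of _ "range V"]) blast+
  qed
  show ?thesis
    using cont surj loc by (simp add: covering_space_def)
qed

lemma cont_diff_has_derivative:
  assumes "\<And>x. (f has_derivative f' x) (at x)"
  shows "cont_diff (Suc k) f \<longleftrightarrow> (\<forall>v. cont_diff k (\<lambda>x. f' x v))"
proof -
  have "frechet_derivative f (at x) = f' x" for x
    using frechet_derivative_at[OF assms] by simp
  moreover have "f differentiable (at x)" for x
    using assms differentiable_def by blast
  ultimately show ?thesis by simp
qed

lemma cont_diff_imp_has_derivative:
  "cont_diff (Suc k) f \<Longrightarrow> (f has_derivative frechet_derivative f (at x)) (at x)"
  by (simp add: frechet_derivative_works)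

lemma cont_diff_const: "cont_diff k (\<lambda>x. c)"
proof (induction k arbitrary: c)
  case (Suc k)
  show ?case
    by (subst cont_diff_has_derivative[where f' = "\<lambda>x v. 0"]) (auto intro: Suc)
qed simp

lemma cont_diff_bounded_linear: "bounded_linear f \<Longrightarrow> cont_diff k f"
proof (cases k)
  case (Suc l)
  assume f: "bounded_linear f"
  show ?thesis unfolding Suc
    by (subst cont_diff_has_derivative[where f' = "\<lambda>x. f"])
       (auto intro: cont_diff_const bounded_linear_imp_has_derivative f)
qed (simp add: linear_continuous_on)

lemma cont_diff_mono: "cont_diff (Suc k) f \<Longrightarrow> cont_diff k f"
proof (induction k arbitrary: f)
  case 0
  then show ?case
    by (simp add: continuous_on_eq_continuous_at differentiable_imp_continuous_within)
next
  case (Suc k)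
  then show ?case by (metis cont_diff.simps(2))
qed

lemma cont_diff_add:
  "cont_diff k f \<Longrightarrow> cont_diff k g \<Longrightarrow> cont_diff k (\<lambda>x. f x + g x)"
proof (induction k arbitrary: f g)
  case (Suc k)
  note der = Suc.prems[THEN cont_diff_imp_has_derivative]
  show ?case
    by (subst cont_diff_has_derivative[OF has_derivative_add[OF der]])
       (use Suc in auto)
qed (simp add: continuous_on_add)

lemma cont_diff_bilinear:
  assumes B: "bounded_bilinear B"
  shows "cont_diff k f \<Longrightarrow> cont_diff k g \<Longrightarrow> cont_diff k (\<lambda>x. B (f x) (g x))"
proof (induction k arbitrary: f g)
  case 0
  then show ?case by (simp add: bounded_bilinear.continuous_on[OF B])
next
  case (Suc k)
  note der = Suc.prems[THEN cont_diff_imp_has_derivative]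
  have "cont_diff k (\<lambda>x. frechet_derivative f (at x) v)"
    "cont_diff k (\<lambda>x. frechet_derivative g (at x) v)" for v
    using Suc.prems by auto
  then show ?case
    by (subst cont_diff_has_derivative[OF bounded_bilinear.FDERIV[OF B der]])
       (auto intro!: cont_diff_add Suc.IH Suc.prems[THEN cont_diff_mono])
qed

lemma cont_diff_cis: "bounded_linear f \<Longrightarrow> cont_diff k (\<lambda>x. cis (f x))"
proof (induction k)
  case 0
  then show ?case by (simp add: linear_continuous_on continuous_on_cis)
next
  case (Suc k)
  show ?case
    by (subst cont_diff_has_derivative
          [OF has_derivative_cis[OF bounded_linear_imp_has_derivative[OF Suc.prems]]])
       (auto intro!: cont_diff_bilinear[OF bounded_bilinear_scaleR] cont_diff_const
          cont_diff_bilinear[OF bounded_bilinear_mult] Suc)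
qed

lemma cont_diff_linear_compose:
  assumes L: "bounded_linear L"
  shows "cont_diff k f \<Longrightarrow> cont_diff k (\<lambda>x. L (f x))"
proof (induction k arbitrary: f)
  case 0
  then show ?case by (simp add: bounded_linear.continuous_on[OF L])
next
  case (Suc k)
  have "cont_diff k (\<lambda>x. frechet_derivative f (at x) v)" for v
    using Suc.prems by simp
  then show ?case
    by (subst cont_diff_has_derivative
          [OF bounded_linear.has_derivative[OF L cont_diff_imp_has_derivative[OF Suc.prems]]])
       (simp add: Suc.IH)
qed

lemma cont_diff_Pair:
  assumes "cont_diff k f" "cont_diff k g"
  shows "cont_diff k (\<lambda>x. (f x, g x))"
proof -
  have "bounded_linear (\<lambda>a. (a, 0))" "bounded_linear (\<lambda>b. (0, b))"
    by (simp_all add: bounded_linear_Pair bounded_linear_ident bounded_linear_zero)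
  then have "cont_diff k (\<lambda>x. (f x, 0) + (0, g x))"
    using assms by (intro cont_diff_add cont_diff_linear_compose[where L = "\<lambda>a. (a, 0)"]
        cont_diff_linear_compose[where L = "\<lambda>b. (0, b)"])
  then show ?thesis by simp
qed

lemma lie_group_E0_2_cover: "lie_group E0_2_cover"
proof -
  interpret group E0_2_cover by (rule group_E0_2_cover)
  have "inv\<^bsub>E0_2_cover\<^esub> (t, b) = (- t, - (cis (- t) * b))" for t b
    by (rule inv_equality) auto
  then have inv: "(\<lambda>x. inv\<^bsub>E0_2_cover\<^esub> x) = (\<lambda>x. (- fst x, - (cis (- fst x) * snd x)))"
    by (auto simp: fun_eq_iff)
  have mult: "(\<lambda>(x, y). x \<otimes>\<^bsub>E0_2_cover\<^esub> y) = (\<lambda>p. (fst (fst p) + fst (snd p),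
      snd (fst p) + cis (fst (fst p)) * snd (snd p)))"
    by (auto simp: fun_eq_iff)
  have "smooth (\<lambda>(x, y). x \<otimes>\<^bsub>E0_2_cover\<^esub> y)"
    unfolding mult smooth_def
    by (intro allI cont_diff_Pair cont_diff_add cont_diff_bilinear[OF bounded_bilinear_mult]
        cont_diff_cis cont_diff_bounded_linear bounded_linear_fst_comp bounded_linear_snd_comp
        bounded_linear_fst bounded_linear_snd)
  moreover have "smooth (\<lambda>x. inv\<^bsub>E0_2_cover\<^esub> x)"
    unfolding inv smooth_def
    by (intro allI cont_diff_Pair cont_diff_linear_compose[OF bounded_linear_minus[OF bounded_linear_ident]]
        cont_diff_bilinear[OF bounded_bilinear_mult]
        cont_diff_cis cont_diff_bounded_linear bounded_linear_minus bounded_linear_fst bounded_linear_snd)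
  ultimately show ?thesis by (simp add: lie_group_def group_E0_2_cover)
qed

lemma simply_connected_E0_2_cover: "simply_connected (carrier E0_2_cover)"
  by (simp add: convex_imp_simply_connected)

lemma lie_bracket_E0_2_cover:
  "lie_bracket E0_2_cover (s, z) (s', z') = (0, \<i> * (of_real s * z' - of_real s' * z))"
proof -
  have ltd: "left_translation_deriv E0_2_cover (t, b) p = (\<lambda>(s, z). (s, cis t * z))" for t b p
  proof -
    have "((\<lambda>x. (t, b) \<otimes>\<^bsub>E0_2_cover\<^esub> x) has_derivative (\<lambda>(s, z). (s, cis t * z))) (at p)"
      unfolding E0_2_cover_def case_prod_beta by (auto intro!: derivative_eq_intros)
    then show ?thesis
      unfolding left_translation_deriv_def using frechet_derivative_at by metis
  qed
  have lif: "left_invariant_field E0_2_cover (s, z) = (\<lambda>p. (s, cis (fst p) * z))" for s z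
    by (auto simp: left_invariant_field_def fun_eq_iff ltd)
  have "((\<lambda>p :: real \<times> complex. (s, cis (fst p) * z)) has_derivative
      (\<lambda>v. (0, \<i> * of_real (fst v) * z))) (at (0, 0))" for s :: real and z
    by (auto intro!: derivative_eq_intros simp: fun_eq_iff scaleR_conv_of_real)
  then have fd: "frechet_derivative (\<lambda>p :: real \<times> complex. (s, cis (fst p) * z)) (at (0, 0))
      = (\<lambda>v. (0, \<i> * of_real (fst v) * z))" for s :: real and z
    by (rule frechet_derivative_at[symmetric])
  show ?thesis
    by (simp add: lie_bracket_def vector_field_bracket_def lif fd) (simp add: algebra_simps)
qed

end

theory Submission
  imports Defs
begin

text \<open>
  Let \<open>V\<close> be the plane spanned by \<open>X\<^sub>2, X\<^sub>3\<close>. Automorphisms of the Lie algebra allow us to add any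
  element of \<open>V\<close> to \<open>X\<^sub>1\<close> and to apply to \<open>V\<close> any rotation and homothety, so the metric can be
  made diagonal on \<open>V\<close> with \<open>X\<^sub>3\<close> spacelike. The three normal forms correspond to \<open>X\<^sub>2\<close> being
  spacelike, timelike or null: in the first two cases \<open>X\<^sub>1\<close> is made orthogonal to \<open>V\<close> and then null by
  adding a multiple of \<open>X\<^sub>2\<close>; in the third, nondegeneracy gives \<open>\<langle>X\<^sub>1, X\<^sub>2\<rangle> \<noteq> 0\<close>, so that adding
  elements of \<open>V\<close> to \<open>X\<^sub>1\<close> makes it null and orthogonal to \<open>X\<^sub>3\<close>.
\<close>

section \<open>Lorentzian forms\<close>

text \<open>The inverse map \<open>g\<close> carries an orthonormal basis for \<open>B\<close> to
  one for the pulled back form. This serves both for transport along left translations and for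
  automorphisms.\<close>

lemma lorentzian_form_compose:
  fixes B :: "'a::euclidean_space \<Rightarrow> 'a \<Rightarrow> real"
  assumes B: "lorentzian_form B" and f: "linear f" and g: "linear g"
    and fg: "\<And>x. f (g x) = x" and gf: "\<And>x. g (f x) = x"
  shows "lorentzian_form (\<lambda>v w. B (f v) (f w))"
proof -
  obtain b where b: "is_basis b"
    and gram: "gram_matrix B b = vector [vector [1, 0, 0], vector [0, 1, 0], vector [0, 0, -1]]"
    using B unfolding lorentzian_form_def by blast+
  have bil: "bilinear B" and nondeg: "\<And>v. (\<forall>w. B v w = 0) \<Longrightarrow> v = 0"
    and sym: "\<And>v w. B v w = B w v"
    using B unfolding lorentzian_form_def by blast+
  have "inj g" using fg by (metis injI)
  have "surj g" using gf by (metis surjI)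
  have "is_basis (g \<circ> b)"
    unfolding is_basis_def
  proof (intro conjI)
    show "inj (g \<circ> b)" using b \<open>inj g\<close> by (simp add: is_basis_def inj_compose)
    show "independent (range (g \<circ> b))"
      using b \<open>inj g\<close> linear_independent_injective_image[OF g, of "range b"]
      by (simp add: is_basis_def image_comp inj_on_subset)
    show "span (range (g \<circ> b)) = UNIV"
      using b \<open>surj g\<close> linear_span_image[OF g, of "range b"]
      by (simp add: is_basis_def image_comp)
  qed
  moreover have "gram_matrix (\<lambda>v w. B (f v) (f w)) (g \<circ> b) = gram_matrix B b"
    by (simp add: gram_matrix_def fg)
  moreover have "bilinear (\<lambda>v w. B (f v) (f w))"
    using bil linear_compose[OF f] by (auto simp: bilinear_def o_def)
  moreover have "v = 0" if "\<forall>w. B (f v) (f w) = 0" for v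
  proof -
    have "f v = 0" using that nondeg fg by metis
    then show ?thesis using gf[of v] linear_0[OF g] by simp
  qed
  ultimately show ?thesis
    unfolding lorentzian_form_def using gram sym by metis
qed

lemma lorentzian_form_coordinates:
  assumes "lorentzian_form B"
  obtains b :: "3 \<Rightarrow> 'a::euclidean_space" where
    "\<And>v. \<exists>x y z. v = x *\<^sub>R b 1 + y *\<^sub>R b 2 + z *\<^sub>R b 3"
    "\<And>x y z. B (x *\<^sub>R b 1 + y *\<^sub>R b 2 + z *\<^sub>R b 3) (x *\<^sub>R b 1 + y *\<^sub>R b 2 + z *\<^sub>R b 3)
       = x\<^sup>2 + y\<^sup>2 - z\<^sup>2"
proof -
  obtain b where b: "is_basis b"
    and gram: "gram_matrix B b = vector [vector [1, 0, 0], vector [0, 1, 0], vector [0, 0, -1]]"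
    using assms by (auto simp: lorentzian_form_def)
  have bil: "bilinear B" using assms by (simp add: lorentzian_form_def)
  have entry: "B (b i) (b j)
      = (vector [vector [1, 0, 0], vector [0, 1, 0], vector [0, 0, -1]] :: real^3^3) $ i $ j" for i j
    by (simp add: gram_matrix_def flip: gram)
  have entries: "B (b 1) (b 1) = 1" "B (b 1) (b 2) = 0" "B (b 1) (b 3) = 0"
      "B (b 2) (b 1) = 0" "B (b 2) (b 2) = 1" "B (b 2) (b 3) = 0"
      "B (b 3) (b 1) = 0" "B (b 3) (b 2) = 0" "B (b 3) (b 3) = -1"
    by (simp_all add: entry)
  have "\<exists>x y z. v = x *\<^sub>R b 1 + y *\<^sub>R b 2 + z *\<^sub>R b 3" for v
  proof -
    have "range b = {b 1, b 2, b 3}" by (simp add: UNIV_3)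
    then have "v \<in> span {b 1, b 2, b 3}" using b unfolding is_basis_def by simp
    then obtain x y z where "v - x *\<^sub>R b 1 - y *\<^sub>R b 2 = z *\<^sub>R b 3"
      by (auto simp: span_breakdown_eq span_singleton)
    then have "v = x *\<^sub>R b 1 + y *\<^sub>R b 2 + z *\<^sub>R b 3" by (simp add: algebra_simps)
    then show ?thesis by blast
  qed
  moreover have "B (x *\<^sub>R b 1 + y *\<^sub>R b 2 + z *\<^sub>R b 3) (x *\<^sub>R b 1 + y *\<^sub>R b 2 + z *\<^sub>R b 3)
      = x\<^sup>2 + y\<^sup>2 - z\<^sup>2" for x y z
    using bil
    by (simp add: bilinear_ladd bilinear_radd bilinear_lmul bilinear_rmul entries power2_eq_square)
  ultimately show ?thesis by (rule that[of b])
qed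

lemma lorentzian_form_timelike:
  assumes "lorentzian_form B"
  obtains v where "B v v < 0"
proof -
  obtain b where b: "\<And>x y z. B (x *\<^sub>R b 1 + y *\<^sub>R b 2 + z *\<^sub>R b 3) (x *\<^sub>R b 1 + y *\<^sub>R b 2 + z *\<^sub>R b (3::3))
       = x\<^sup>2 + y\<^sup>2 - z\<^sup>2"
    using lorentzian_form_coordinates[OF assms] by metis
  show ?thesis using that[of "b 3"] b[of 0 0 1] by simp
qed

text \<open>The signature has a single minus sign, so by dimension every plane contains a nonzero
  vector with vanishing timelike coordinate.\<close>

lemma lorentzian_form_spacelike_in_plane:
  assumes B: "lorentzian_form B"
    and indep: "\<And>x y. x *\<^sub>R v + y *\<^sub>R w = 0 \<Longrightarrow> x = 0 \<and> y = 0"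
  obtains x y where "B (x *\<^sub>R v + y *\<^sub>R w) (x *\<^sub>R v + y *\<^sub>R w) > 0"
proof -
  obtain b where ex: "\<And>v. \<exists>x y z. v = x *\<^sub>R b 1 + y *\<^sub>R b 2 + z *\<^sub>R b (3::3)"
    and b: "\<And>x y z. B (x *\<^sub>R b 1 + y *\<^sub>R b 2 + z *\<^sub>R b 3) (x *\<^sub>R b 1 + y *\<^sub>R b 2 + z *\<^sub>R b (3::3))
       = x\<^sup>2 + y\<^sup>2 - z\<^sup>2"
    using lorentzian_form_coordinates[OF B] by metis
  obtain v1 v2 v3 where v: "v = v1 *\<^sub>R b 1 + v2 *\<^sub>R b 2 + v3 *\<^sub>R b 3" using ex by blast
  obtain w1 w2 w3 where w: "w = w1 *\<^sub>R b 1 + w2 *\<^sub>R b 2 + w3 *\<^sub>R b 3" using ex by blast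
  \<comment> \<open>A nontrivial solution of one linear equation in two unknowns kills the
    coordinate along the timelike vector \<open>b 3\<close>.\<close>
  obtain x y where xy: "x \<noteq> 0 \<or> y \<noteq> 0" "x * v3 + y * w3 = 0"
  proof (cases "v3 = 0 \<and> w3 = 0")
    case True
    then show ?thesis using that[of 1 0] by simp
  next
    case False
    then show ?thesis using that[of w3 "- v3"] by auto
  qed
  define p q where "p = x * v1 + y * w1" and "q = x * v2 + y * w2"
  have "x *\<^sub>R v + y *\<^sub>R w = p *\<^sub>R b 1 + q *\<^sub>R b 2 + (x * v3 + y * w3) *\<^sub>R b 3"
    by (simp add: v w p_def q_def algebra_simps)
  then have comb: "x *\<^sub>R v + y *\<^sub>R w = p *\<^sub>R b 1 + q *\<^sub>R b 2 + 0 *\<^sub>R b 3" by (simp add: xy)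
  have "p \<noteq> 0 \<or> q \<noteq> 0" using comb indep[of x y] xy(1) by auto
  then have "p\<^sup>2 + q\<^sup>2 - 0\<^sup>2 > 0" by (simp add: sum_power2_gt_zero_iff)
  then show ?thesis using that b comb by metis
qed

section \<open>Normal forms\<close>

text \<open>
  Here \<open>(s, w), (0, z), (0, \<i> * s * z)\<close> with \<open>s = \<plusminus>1\<close> and \<open>z \<noteq> 0\<close> is the general frame satisfying
  the bracket relations of the theorem.
\<close>

lemma lorentzian_form_normal_frame:
  fixes B :: "real \<times> complex \<Rightarrow> real \<times> complex \<Rightarrow> real"
  assumes B: "lorentzian_form B" and s: "s\<^sup>2 = 1"
  obtains w z where "z \<noteq> 0" "B (s, w) (s, w) = 0"
    "B (s, w) (0, \<i> * of_real s * z) = 0" "B (0, z) (0, \<i> * of_real s * z) = 0"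
    "B (0, \<i> * of_real s * z) (0, \<i> * of_real s * z) > 0"
    "B (0, z) (0, z) \<ge> 0 \<and> B (s, w) (0, z) = 1 \<or> B (0, z) (0, z) < 0 \<and> B (s, w) (0, z) = - 1"
proof -
  have bil: "bilinear B" and sym: "\<And>v w. B v w = B w v"
    and nondeg: "\<And>v. (\<forall>w. B v w = 0) \<Longrightarrow> v = 0"
    using B unfolding lorentzian_form_def by blast+
  note frameI = that
  note lin = bilinear_ladd[OF bil] bilinear_radd[OF bil] bilinear_lmul[OF bil] bilinear_rmul[OF bil]
  obtain z0 :: complex where z0: "z0 \<noteq> 0" "B (0, z0) (0, \<i> * z0) = 0"
  proof -
    define E F G where "E = B (0, 1) (0, 1)" and "F = B (0, 1) (0, \<i>)" and "G = B (0, \<i>) (0, \<i>)"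
    show ?thesis
    proof (cases "F = 0")
      case True
      then show ?thesis using that[of 1] by (simp add: F_def)
    next
      case False
      \<comment> \<open>\<open>F * q\<^sup>2 - (G - E) * q - F = 0\<close> expresses that
        \<open>1 + \<i> * q\<close> is orthogonal to its quarter turn. Its discriminant
        \<open>d\<close> is a sum of squares, so a real root \<open>q\<close> exists.\<close>
      define d where "d = (G - E)\<^sup>2 + 4 * F\<^sup>2"
      define q where "q = (G - E + sqrt d) / (2 * F)"
      have "d \<ge> 0" by (simp add: d_def)
      have "2 * F * q = G - E + sqrt d" using False by (simp add: q_def)
      then have "(2 * F * q - (G - E))\<^sup>2 = d" using \<open>d \<ge> 0\<close> by simp
      then have "4 * F * (F * q\<^sup>2 - (G - E) * q - F) = 0"
        unfolding d_def by (simp add: power2_eq_square algebra_simps)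
      then have q: "F * q\<^sup>2 - (G - E) * q - F = 0" using False by simp
      have eqs: "(0, Complex 1 q) = (0, 1) + q *\<^sub>R (0::real, \<i>)"
        "(0, \<i> * Complex 1 q) = (0, \<i>) + (- q) *\<^sub>R (0::real, 1)"
        by (simp_all add: complex_eq_iff)
      have "B (0, Complex 1 q) (0, \<i> * Complex 1 q) = F - q * E + q * G - q\<^sup>2 * F"
        unfolding eqs lin
        by (simp add: sym[of "(0, \<i>)" "(0, 1)"] E_def F_def G_def power2_eq_square algebra_simps)
      then show ?thesis
        using that[of "Complex 1 q"] q by (auto simp: algebra_simps complex_eq_iff)
    qed
  qed
  have indep: "x = 0 \<and> y = 0" if "x *\<^sub>R (0::real, a) + y *\<^sub>R (0, \<i> * a) = 0" "a \<noteq> 0" for x y a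
  proof -
    have "Complex x y * a = x *\<^sub>R a + y *\<^sub>R (\<i> * a)" by (simp add: complex_eq_iff)
    also have "\<dots> = 0" using that(1) by (simp add: zero_prod_def)
    finally have "Complex x y = 0" using that(2) by simp
    then show ?thesis by (simp add: complex_eq_iff)
  qed
  \<comment> \<open>The plane contains a spacelike vector, so one of the orthogonal vectors given by
    \<open>z0\<close> and \<open>\<i> * z0\<close> is spacelike. If the latter is not, a quarter
    turn exchanges their roles up to sign.\<close>
  obtain z1 :: complex where z1: "z1 \<noteq> 0" "B (0, z1) (0, \<i> * z1) = 0" "B (0, \<i> * z1) (0, \<i> * z1) > 0"
  proof (cases "B (0, \<i> * z0) (0, \<i> * z0) > 0")
    case True
    then show ?thesis using that z0 by blast
  next
    case False
    obtain x y where "B (x *\<^sub>R (0, z0) + y *\<^sub>R (0, \<i> * z0)) (x *\<^sub>R (0, z0) + y *\<^sub>R (0, \<i> * z0)) > 0"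
      using lorentzian_form_spacelike_in_plane[OF B, of "(0, z0)" "(0, \<i> * z0)"] indep z0(1) by metis
    then have "x\<^sup>2 * B (0, z0) (0, z0) + y\<^sup>2 * B (0, \<i> * z0) (0, \<i> * z0) > 0"
      unfolding lin using z0(2) by (simp add: sym[of "(0, \<i> * z0)" "(0, z0)"] power2_eq_square)
    moreover have "y\<^sup>2 * B (0, \<i> * z0) (0, \<i> * z0) \<le> 0"
      using False by (simp add: mult_nonneg_nonpos)
    ultimately have "x\<^sup>2 * B (0, z0) (0, z0) > 0" by linarith
    then have pos: "B (0, z0) (0, z0) > 0" by (simp add: zero_less_mult_iff)
    have neg: "(0, - z0) = (- 1) *\<^sub>R (0::real, z0)" by simp
    have "B (0, \<i> * z0) (0, - z0) = 0" "B (0, - z0) (0, - z0) > 0"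
      unfolding neg lin using pos z0(2) by (simp_all add: sym[of "(0, \<i> * z0)"])
    then show ?thesis using that[of "\<i> * z0"] z0(1) by (simp add: mult.assoc[symmetric])
  qed
  define f g where "f = (0::real, z1)" and "g = (0::real, \<i> * z1)"
  define l m where "l = B f f" and "m = B g g"
  have fg: "B f g = 0" "B g f = 0" and m: "m > 0"
    using z1 by (simp_all add: f_def g_def m_def sym)
  have "s \<noteq> 0" using s by auto
  \<comment> \<open>Since \<open>s\<close> is nonzero, the first component fixes \<open>x\<close>;
    complex division of the remainder by \<open>z1\<close> yields the coordinates along
    \<open>f\<close> and \<open>g\<close>.\<close>
  have frame: "\<exists>x y r. v = x *\<^sub>R (s, w) + y *\<^sub>R f + r *\<^sub>R g" for v w
  proof -
    define x where "x = fst v / s"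
    define u where "u = (snd v - x *\<^sub>R w) / z1"
    have "snd v = x *\<^sub>R w + u * z1" using z1(1) by (simp add: u_def)
    also have "u * z1 = Re u *\<^sub>R z1 + Im u *\<^sub>R (\<i> * z1)"
      by (simp add: complex_eq_iff algebra_simps)
    finally have "v = x *\<^sub>R (s, w) + Re u *\<^sub>R f + Im u *\<^sub>R g"
      using \<open>s \<noteq> 0\<close> by (simp add: prod_eq_iff f_def g_def x_def)
    then show ?thesis by blast
  qed
  text \<open>It remains to solve for a coefficient \<open>t\<close> along \<open>f\<close> and a homothety factor \<open>k\<close>.\<close>
  have result: thesis
    if e: "e = (s, w)" and eg: "B e g = 0" and k: "k \<noteq> 0"
      and null: "B e e + 2 * t * B e f + t\<^sup>2 * l = 0"
      and prod: "l \<ge> 0 \<and> k * (B e f + t * l) = 1 \<or> l < 0 \<and> k * (B e f + t * l) = - 1"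
    for e w t k
  proof -
    have eqs: "(s, w + t *\<^sub>R z1) = e + t *\<^sub>R f" "(0, k *\<^sub>R z1) = k *\<^sub>R f"
        "(0, \<i> * of_real s * (k *\<^sub>R z1)) = (s * k) *\<^sub>R g"
      by (simp_all add: e f_def g_def scaleR_conv_of_real)
    have ll: "k * (k * l) = k\<^sup>2 * l" by (simp add: power2_eq_square)
    have "s * k \<noteq> 0" using k \<open>s \<noteq> 0\<close> by simp
    then have sk: "(s * k) * ((s * k) * m) > 0" using m by (metis mult.assoc mult_pos_pos not_real_square_gt_zero)
    show thesis
    proof (rule frameI[of "k *\<^sub>R z1" "w + t *\<^sub>R z1"])
      show "k *\<^sub>R z1 \<noteq> 0" using k z1 by simp
      show "B (s, w + t *\<^sub>R z1) (s, w + t *\<^sub>R z1) = 0"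
        unfolding eqs lin using null
        by (simp add: sym[of f e] power2_eq_square algebra_simps flip: l_def)
      show "B (s, w + t *\<^sub>R z1) (0, \<i> * of_real s * (k *\<^sub>R z1)) = 0"
        "B (0, k *\<^sub>R z1) (0, \<i> * of_real s * (k *\<^sub>R z1)) = 0"
        unfolding eqs lin by (simp_all add: fg eg)
      show "B (0, \<i> * of_real s * (k *\<^sub>R z1)) (0, \<i> * of_real s * (k *\<^sub>R z1)) > 0"
        unfolding eqs lin using sk by (simp only: m_def real_scaleR_def)
      show "B (0, k *\<^sub>R z1) (0, k *\<^sub>R z1) \<ge> 0 \<and> B (s, w + t *\<^sub>R z1) (0, k *\<^sub>R z1) = 1
          \<or> B (0, k *\<^sub>R z1) (0, k *\<^sub>R z1) < 0 \<and> B (s, w + t *\<^sub>R z1) (0, k *\<^sub>R z1) = - 1"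
        unfolding eqs lin using prod k by (auto simp: ll mult_pos_neg simp flip: l_def)
    qed
  qed
  \<comment> \<open>Orthogonal projection along \<open>g\<close>, possible because
    \<open>m > 0\<close>.\<close>
  define e0 where "e0 = (s, 0::complex) + (- B (s, 0) g / m) *\<^sub>R g"
  obtain w0 where e0: "e0 = (s, w0)" by (simp add: e0_def g_def)
  have e0g: "B e0 g = 0" unfolding e0_def lin using m by (simp flip: m_def)
  show thesis
  proof (cases "l = 0")
    case True
    \<comment> \<open>Here \<open>f\<close> is null and orthogonal to \<open>g\<close>; were it also
      orthogonal to \<open>e0\<close>, it would lie in the radical of \<open>B\<close>.\<close>
    have "B e0 f \<noteq> 0"
    proof
      assume "B e0 f = 0"
      then have zero: "B f e0 = 0" using sym by metis
      have "B f v = 0" for v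
        using frame[of v w0] unfolding e0[symmetric]
        by (auto simp: lin fg zero True simp flip: l_def)
      then have "f = 0" using nondeg by blast
      then show False using z1(1) by (simp add: f_def zero_prod_def)
    qed
    \<comment> \<open>With \<open>l = 0\<close> the condition that \<open>e0 + t *\<^sub>R f\<close>
      be null is linear in \<open>t\<close>, and adding multiples of \<open>f\<close> leaves the
      product with \<open>f\<close> unchanged.\<close>
    then show ?thesis
      using result[OF e0 e0g, of "1 / B e0 f" "- B e0 e0 / (2 * B e0 f)"] True by simp
  next
    case False
    \<comment> \<open>As \<open>f\<close> is not null, \<open>e0\<close> can also be made orthogonal
      to \<open>f\<close>, which makes the frame orthogonal.\<close>
    define e where "e = e0 + (- B e0 f / l) *\<^sub>R f"
    obtain w where e: "e = (s, w)" by (simp add: e_def e0 f_def)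
    have eg: "B e g = 0" unfolding e_def lin by (simp add: fg e0g)
    have ef: "B e f = 0" unfolding e_def lin using False by (simp flip: l_def)
    have ge: "B g e = 0" "B f e = 0" using eg ef sym by metis+
    define c where "c = B e e"
    have quad: "B (x *\<^sub>R e + y *\<^sub>R f + r *\<^sub>R g) (x *\<^sub>R e + y *\<^sub>R f + r *\<^sub>R g) = x\<^sup>2 * c + y\<^sup>2 * l + r\<^sup>2 * m"
      for x y r
      by (simp add: lin fg eg ef ge power2_eq_square flip: c_def l_def m_def)
    \<comment> \<open>Since \<open>g\<close> is spacelike, the signature forces \<open>c\<close> and
      \<open>l\<close> to have opposite signs: if \<open>l > 0\<close>, only \<open>c\<close> can
      account for a timelike vector; if \<open>l < 0\<close>, the plane of \<open>e\<close> and
      \<open>f\<close> needs \<open>c > 0\<close> to contain a spacelike vector.\<close>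
    have cl: "c / l < 0"
    proof (cases "l > 0")
      case True
      obtain v where v: "B v v < 0" using lorentzian_form_timelike[OF B] .
      obtain x y r where "v = x *\<^sub>R e + y *\<^sub>R f + r *\<^sub>R g" using frame e by metis
      then have "x\<^sup>2 * c + y\<^sup>2 * l + r\<^sup>2 * m < 0" using v quad by metis
      moreover have "y\<^sup>2 * l \<ge> 0" "r\<^sup>2 * m \<ge> 0" using True m by simp_all
      ultimately have "x\<^sup>2 * c < 0" by linarith
      then have "c < 0" by (simp add: mult_less_0_iff)
      then show ?thesis using True by (simp add: divide_neg_pos)
    next
      case neg: False
      have "x = 0 \<and> y = 0" if "x *\<^sub>R e + y *\<^sub>R f = 0" for x y
        using that \<open>s \<noteq> 0\<close> z1(1) by (auto simp: e f_def zero_prod_def)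
      then obtain x y where "B (x *\<^sub>R e + y *\<^sub>R f) (x *\<^sub>R e + y *\<^sub>R f) > 0"
        using lorentzian_form_spacelike_in_plane[OF B] by blast
      then have "x\<^sup>2 * c + y\<^sup>2 * l > 0" using quad[of x y 0] by simp
      moreover have "y\<^sup>2 * l \<le> 0" using neg by (simp add: mult_nonneg_nonpos)
      ultimately have "x\<^sup>2 * c > 0" by linarith
      then have "c > 0" by (simp add: zero_less_mult_iff)
      then show ?thesis using neg False by (simp add: divide_pos_neg)
    qed
    define t where "t = sqrt (- (c / l))"
    have "t > 0" "t\<^sup>2 = - (c / l)" using cl by (simp_all add: t_def)
    then have null: "c + t\<^sup>2 * l = 0" using False by simp
    \<comment> \<open>The product of \<open>e + t *\<^sub>R f\<close> with \<open>f\<close> is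
      \<open>t * l\<close>, so this homothety factor scales it to the sign of
      \<open>l\<close>.\<close>
    show ?thesis
      using result[OF e eg, of "1 / (t * \<bar>l\<bar>)" t] null \<open>t > 0\<close> False
      by (cases "l > 0") (simp_all add: ef flip: c_def)
  qed
qed

lemma gram_matrix_3:
  "gram_matrix B b = vector
     [vector [B (b 1) (b 1), B (b 1) (b 2), B (b 1) (b 3)],
      vector [B (b 2) (b 1), B (b 2) (b 2), B (b 2) (b 3)],
      vector [B (b 3) (b 1), B (b 3) (b 2), B (b 3) (b 3)]]"
  by (simp add: gram_matrix_def vec_eq_iff forall_3)

section \<open>Left invariant metrics\<close>

text \<open>Left translation by the inverse of \<open>p\<close> brings tangent vectors at
  \<open>p\<close> back to the unit; its differential rotates the plane component by
  \<open>cis (- fst p)\<close>.\<close>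

definition left_invariant_extension ::
  "(real \<times> complex \<Rightarrow> real \<times> complex \<Rightarrow> real)
     \<Rightarrow> real \<times> complex \<Rightarrow> real \<times> complex \<Rightarrow> real \<times> complex \<Rightarrow> real" where
  "left_invariant_extension B p v w =
     B (fst v, cis (- fst p) * snd v) (fst w, cis (- fst p) * snd w)"

lemma left_translation_deriv_E0_2_cover:
  "left_translation_deriv E0_2_cover a p v = (fst v, cis (fst a) * snd v)"
proof -
  have "((\<lambda>x. a \<otimes>\<^bsub>E0_2_cover\<^esub> x) has_derivative (\<lambda>v. (fst v, cis (fst a) * snd v))) (at p)"
    unfolding E0_2_cover_def case_prod_beta by (auto intro!: derivative_eq_intros)
  then show ?thesis
    unfolding left_translation_deriv_def by (simp flip: frechet_derivative_at)
qed

lemma left_invariant_extension_unit [simp]: "left_invariant_extension B (0, 0) = B"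
  by (simp add: left_invariant_extension_def fun_eq_iff)

text \<open>Every tangent vector at \<open>p\<close> is the image under left translation by
  \<open>p\<close> of a vector at the unit, so invariance determines \<open>h p\<close> from the
  form there.\<close>

lemma left_invariant_imp_extension:
  assumes "left_invariant E0_2_cover h"
  shows "h = left_invariant_extension (h (0, 0))"
proof (intro ext)
  fix p v w
  have "h p v w = h (p \<otimes>\<^bsub>E0_2_cover\<^esub> (0, 0))
      (left_translation_deriv E0_2_cover p (0, 0) (fst v, cis (- fst p) * snd v))
      (left_translation_deriv E0_2_cover p (0, 0) (fst w, cis (- fst p) * snd w))"
    by (cases p) (simp add: left_translation_deriv_E0_2_cover cis_mult flip: mult.assoc)
  also have "\<dots> = left_invariant_extension (h (0, 0)) p v w"
    using assms by (simp only: left_invariant_def left_invariant_extension_def)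
  finally show "h p v w = left_invariant_extension (h (0, 0)) p v w" .
qed

lemma left_invariant_left_invariant_extension:
  "left_invariant E0_2_cover (left_invariant_extension B)"
  by (auto simp: left_invariant_def left_invariant_extension_def left_translation_deriv_E0_2_cover
      cis_mult simp flip: mult.assoc)

lemma linear_mult_snd: "linear (\<lambda>v :: real \<times> complex. (fst v, a * snd v))"
  by (intro linearI) (simp_all add: algebra_simps)

lemma lorentzian_metric_left_invariant_extension:
  assumes B: "lorentzian_form B"
  shows "lorentzian_metric (left_invariant_extension B)"
  unfolding lorentzian_metric_def
proof (intro conjI allI)
  fix p
  show "lorentzian_form (left_invariant_extension B p)"
    unfolding left_invariant_extension_def
    by (rule lorentzian_form_compose[OF B, where g = "\<lambda>v. (fst v, cis (fst p) * snd v)"])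
       (simp_all add: linear_mult_snd cis_mult flip: mult.assoc)
next
  fix v w
  have "bounded_bilinear B"
    using B by (simp add: lorentzian_form_def bilinear_conv_bounded_bilinear)
  moreover have "cont_diff k (\<lambda>p :: real \<times> complex. (fst v, cis (- fst p) * snd v))"
    for k and v :: "real \<times> complex"
    by (intro cont_diff_Pair cont_diff_const cont_diff_bilinear[OF bounded_bilinear_mult]
        cont_diff_cis bounded_linear_minus bounded_linear_fst)
  ultimately show "smooth (\<lambda>p. left_invariant_extension B p v w)"
    unfolding left_invariant_extension_def smooth_def by (auto intro: cont_diff_bilinear)
qed

section \<open>Automorphisms\<close>

text \<open>
  Up to homothety and rotation of the plane, \<open>cover_aut \<alpha> \<gamma>\<close> is conjugation by a translation.
\<close>

definition cover_aut :: "complex \<Rightarrow> complex \<Rightarrow> real \<times> complex \<Rightarrow> real \<times> complex" where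
  "cover_aut \<alpha> \<gamma> p = (fst p, \<alpha> * snd p + \<gamma> * (cis (fst p) - 1))"

text \<open>The differential of \<open>cover_aut\<close> at the unit, hence a Lie algebra
  automorphism when \<alpha> is nonzero; the factor \<open>\<i>\<close> is the derivative of
  \<open>cis\<close> at 0.\<close>

definition cover_aut_deriv :: "complex \<Rightarrow> complex \<Rightarrow> real \<times> complex \<Rightarrow> real \<times> complex" where
  "cover_aut_deriv \<alpha> \<gamma> v = (fst v, \<alpha> * snd v + \<i> * \<gamma> * of_real (fst v))"

lemma cover_aut_inverse:
  assumes "\<alpha> \<noteq> 0"
  shows "cover_aut \<alpha> \<gamma> (cover_aut (1 / \<alpha>) (- \<gamma> / \<alpha>) p) = p"
    and "cover_aut (1 / \<alpha>) (- \<gamma> / \<alpha>) (cover_aut \<alpha> \<gamma> p) = p"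
    and "cover_aut_deriv \<alpha> \<gamma> (cover_aut_deriv (1 / \<alpha>) (- \<gamma> / \<alpha>) v) = v"
    and "cover_aut_deriv (1 / \<alpha>) (- \<gamma> / \<alpha>) (cover_aut_deriv \<alpha> \<gamma> v) = v"
  using assms by (simp_all add: cover_aut_def cover_aut_deriv_def prod_eq_iff field_simps)

lemma smooth_cover_aut: "smooth (cover_aut \<alpha> \<gamma>)"
proof -
  \<comment> \<open>The rule \<open>cont_diff_add\<close> applies to sums, so the subtraction of 1
    is written as an addition.\<close>
  have "cover_aut \<alpha> \<gamma> = (\<lambda>p. (fst p, \<alpha> * snd p + \<gamma> * (cis (fst p) + (- 1))))"
    by (simp add: cover_aut_def fun_eq_iff)
  show ?thesis
    unfolding \<open>cover_aut \<alpha> \<gamma> = _\<close> smooth_def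
    by (intro allI cont_diff_Pair cont_diff_add cont_diff_bilinear[OF bounded_bilinear_mult]
        cont_diff_const cont_diff_cis cont_diff_bounded_linear bounded_linear_fst bounded_linear_snd)
qed

text \<open>The map is multiplicative because the translation part satisfies the cocycle identity
  \<open>cis (t + t') - 1 = (cis t - 1) + cis t * (cis t' - 1)\<close>. Its inverse lies in the same
  family, hence is smooth too.\<close>

lemma cover_aut_lie_automorphism:
  assumes "\<alpha> \<noteq> 0"
  shows "cover_aut \<alpha> \<gamma> \<in> lie_automorphisms E0_2_cover"
proof -
  have bij: "bij (cover_aut \<alpha> \<gamma>)"
    using cover_aut_inverse(1,2)[OF assms] by (metis bijI')
  have "cover_aut \<alpha> \<gamma> \<in> hom E0_2_cover E0_2_cover"
    by (auto simp: hom_def cover_aut_def algebra_simps simp flip: cis_mult)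
  moreover have "inv_into UNIV (cover_aut \<alpha> \<gamma>) = cover_aut (1 / \<alpha>) (- \<gamma> / \<alpha>)"
    using cover_aut_inverse(1,2)[OF assms] by (intro inv_equality) auto
  ultimately show ?thesis
    using bij by (simp add: lie_automorphisms_def iso_def smooth_cover_aut)
qed

text \<open>This reduces isometry of metrics to the Lie algebra: the rotation
  \<open>cis (fst p)\<close> in the differential at \<open>p\<close> is cancelled by the return to
  the unit.\<close>

lemma pullback_cover_aut:
  "pullback (cover_aut \<alpha> \<gamma>) (left_invariant_extension B) =
     left_invariant_extension (\<lambda>v w. B (cover_aut_deriv \<alpha> \<gamma> v) (cover_aut_deriv \<alpha> \<gamma> w))"
proof -
  have "(cover_aut \<alpha> \<gamma> has_derivative
      (\<lambda>v. (fst v, \<alpha> * snd v + \<gamma> * (fst v *\<^sub>R (\<i> * cis (fst p)))))) (at p)" for p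
    unfolding cover_aut_def by (auto intro!: derivative_eq_intros)
  then have "frechet_derivative (cover_aut \<alpha> \<gamma>) (at p) =
      (\<lambda>v. (fst v, \<alpha> * snd v + \<gamma> * (fst v *\<^sub>R (\<i> * cis (fst p)))))" for p
    by (rule frechet_derivative_at[symmetric])
  moreover have "cis (- t) * (\<alpha> * z + \<gamma> * (r *\<^sub>R (\<i> * cis t)))
      = \<alpha> * (cis (- t) * z) + \<i> * \<gamma> * of_real r" for t z r
  proof -
    have "cis (- t) * (\<alpha> * z + \<gamma> * (r *\<^sub>R (\<i> * cis t)))
        = \<alpha> * (cis (- t) * z) + \<i> * \<gamma> * of_real r * (cis (- t) * cis t)"
      by (simp add: scaleR_conv_of_real algebra_simps)
    then show ?thesis by (simp add: cis_mult)
  qed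
  ultimately show ?thesis
    by (simp add: pullback_def left_invariant_extension_def cover_aut_deriv_def cover_aut_def fun_eq_iff)
qed

lemma lorentzian_form_cover_aut_deriv:
  assumes "lorentzian_form B" "\<alpha> \<noteq> 0"
  shows "lorentzian_form (\<lambda>v w. B (cover_aut_deriv \<alpha> \<gamma> v) (cover_aut_deriv \<alpha> \<gamma> w))"
proof -
  have lin: "linear (cover_aut_deriv a c)" for a c
    unfolding cover_aut_deriv_def by (intro linearI) (simp_all add: algebra_simps scaleR_conv_of_real)
  show ?thesis
    by (rule lorentzian_form_compose[OF assms(1) lin lin cover_aut_inverse(3,4)[OF assms(2)]])
qed

section \<open>The classification\<close>

text \<open>\<open>X 2\<close> and \<open>X 3\<close> are brackets up to sign, so they lie in the
  plane. There \<open>X 1\<close> acts as multiplication by \<open>\<i> * s\<close>; acting twice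
  must give \<open>-1\<close>, whence \<open>s\<^sup>2 = 1\<close>.\<close>

lemma bracket_frame:
  fixes X :: "3 \<Rightarrow> real \<times> complex"
  assumes X: "is_basis X"
    and X12: "lie_bracket E0_2_cover (X 1) (X 2) = X 3"
    and X13: "lie_bracket E0_2_cover (X 1) (X 3) = - X 2"
  obtains s w z where "s\<^sup>2 = 1" "z \<noteq> 0" "X 1 = (s, w)" "X 2 = (0, z)" "X 3 = (0, \<i> * of_real s * z)"
proof -
  obtain s w where X1: "X 1 = (s, w)" by (cases "X 1")
  obtain r z where X2: "X 2 = (r, z)" by (cases "X 2")
  have X3: "X 3 = (0, \<i> * (of_real s * z - of_real r * w))"
    using X12 by (simp add: X1 X2 lie_bracket_E0_2_cover)
  have r: "r = 0" using X13 by (simp add: X1 X2 X3 lie_bracket_E0_2_cover)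
  have "- (\<i> * (of_real s * (\<i> * (of_real s * z)))) = z"
    using X13 by (simp add: X1 X2 X3 r lie_bracket_E0_2_cover)
  then have z: "z = of_real (s\<^sup>2) * z" by (simp add: power2_eq_square algebra_simps)
  have "X 2 \<noteq> 0" using X dependent_zero[of "range X"] rangeI[of X 2] by (auto simp: is_basis_def)
  then have "z \<noteq> 0" using r by (auto simp: X2 zero_prod_def)
  with z have "of_real (s\<^sup>2) = (1 :: complex)" by (metis mult_cancel_right1)
  then have "s\<^sup>2 = 1" by (simp only: of_real_eq_1_iff)
  then show ?thesis using that \<open>z \<noteq> 0\<close> X1 X2 X3 r by (simp add: mult.assoc)
qed

theorem theorem3p5:
  fixes X :: "3 \<Rightarrow> real \<times> complex"
    and h :: "real \<times> complex \<Rightarrow> real \<times> complex \<Rightarrow> real \<times> complex \<Rightarrow> real"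
  assumes "is_basis X"
    and "lie_bracket E0_2_cover (X 1) (X 2) = X 3"
    and "lie_bracket E0_2_cover (X 1) (X 3) = - X 2"
    and "lie_bracket E0_2_cover (X 2) (X 3) = 0"
    and "lorentzian_metric h"
    and "left_invariant E0_2_cover h"
  shows "\<exists>h'. lorentzian_metric h' \<and> left_invariant E0_2_cover h' \<and>
           isometric_via_automorphism E0_2_cover h h' \<and>
           ((\<exists>u v. u > 0 \<and> v > 0 \<and>
               gram_matrix (h' \<one>\<^bsub>E0_2_cover\<^esub>) X =
                 vector [vector [0, 1, 0], vector [1, u, 0], vector [0, 0, v]]) \<or>
            (\<exists>u v. u > 0 \<and> v > 0 \<and>
               gram_matrix (h' \<one>\<^bsub>E0_2_cover\<^esub>) X =
                 vector [vector [0, -1, 0], vector [-1, -u, 0], vector [0, 0, v]]) \<or>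
            (\<exists>u. u > 0 \<and>
               gram_matrix (h' \<one>\<^bsub>E0_2_cover\<^esub>) X =
                 vector [vector [0, 1, 0], vector [1, 0, 0], vector [0, 0, u]]))"
proof -
  obtain s w z where s: "s\<^sup>2 = 1" and z: "z \<noteq> 0"
    and X: "X 1 = (s, w)" "X 2 = (0, z)" "X 3 = (0, \<i> * of_real s * z)"
    using bracket_frame[OF assms(1-3)] .
  define B where "B = h (0, 0)"
  have B: "lorentzian_form B" using assms(5) by (simp add: B_def lorentzian_metric_def)
  have h: "h = left_invariant_extension B"
    unfolding B_def by (rule left_invariant_imp_extension[OF assms(6)])
  obtain w' z' where z': "z' \<noteq> 0" and null: "B (s, w') (s, w') = 0"
    and orth: "B (s, w') (0, \<i> * of_real s * z') = 0" "B (0, z') (0, \<i> * of_real s * z') = 0"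
    and pos: "B (0, \<i> * of_real s * z') (0, \<i> * of_real s * z') > 0"
    and sign: "B (0, z') (0, z') \<ge> 0 \<and> B (s, w') (0, z') = 1
      \<or> B (0, z') (0, z') < 0 \<and> B (s, w') (0, z') = - 1"
    using lorentzian_form_normal_frame[OF B s] .
  have sym: "B v w = B w v" for v w using B unfolding lorentzian_form_def by blast
  have "s \<noteq> 0" using s by auto
  \<comment> \<open>These parameters make the differential send the given basis \<open>X\<close> to
    the normal frame of \<open>B\<close>: \<alpha> matches the plane vectors, \<gamma> then corrects
    the first one.\<close>
  define \<alpha> \<gamma> where "\<alpha> = z' / z" and "\<gamma> = (w' - \<alpha> * w) / (\<i> * of_real s)"
  have "\<alpha> \<noteq> 0" using z z' by (simp add: \<alpha>_def)
  define D where "D = cover_aut_deriv \<alpha> \<gamma>"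
  define B' where "B' = (\<lambda>v w. B (D v) (D w))"
  have DX: "D (X 1) = (s, w')" "D (X 2) = (0, z')" "D (X 3) = (0, \<i> * of_real s * z')"
    using z \<open>s \<noteq> 0\<close> by (simp_all add: D_def cover_aut_deriv_def X \<alpha>_def \<gamma>_def)
  define h' where "h' = left_invariant_extension B'"
  have "lorentzian_form B'"
    unfolding B'_def D_def using B \<open>\<alpha> \<noteq> 0\<close> by (rule lorentzian_form_cover_aut_deriv)
  then have "lorentzian_metric h'"
    unfolding h'_def by (rule lorentzian_metric_left_invariant_extension)
  moreover have "left_invariant E0_2_cover h'"
    unfolding h'_def by (rule left_invariant_left_invariant_extension)
  moreover have "isometric_via_automorphism E0_2_cover h h'"
    unfolding isometric_via_automorphism_def
  proof
    \<comment> \<open>The metric \<open>h'\<close> is \<open>h\<close> pulled back along the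
      automorphism with differential \<open>D\<close>, so the inverse automorphism pulls
      \<open>h'\<close> back to \<open>h\<close>.\<close>
    show "cover_aut (1 / \<alpha>) (- \<gamma> / \<alpha>) \<in> lie_automorphisms E0_2_cover"
      using \<open>\<alpha> \<noteq> 0\<close> by (simp add: cover_aut_lie_automorphism)
    show "h = pullback (cover_aut (1 / \<alpha>) (- \<gamma> / \<alpha>)) h'"
      unfolding h h'_def pullback_cover_aut B'_def D_def cover_aut_inverse(3)[OF \<open>\<alpha> \<noteq> 0\<close>] ..
  qed
  moreover have "gram_matrix (h' \<one>\<^bsub>E0_2_cover\<^esub>) X = vector
     [vector [0, B (s, w') (0, z'), 0],
      vector [B (s, w') (0, z'), B (0, z') (0, z'), 0],
      vector [0, 0, B (0, \<i> * of_real s * z') (0, \<i> * of_real s * z')]]"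
    by (simp add: h'_def B'_def gram_matrix_3 DX null orth sym[of "(0, z')" "(s, w')"]
        sym[of "(0, \<i> * of_real s * z')" "(s, w')"] sym[of "(0, \<i> * of_real s * z')" "(0, z')"])
  \<comment> \<open>The nonnegative alternative splits into the first and third normal forms; in the
    second, \<open>u\<close> is the negated square of \<open>(0, z')\<close>.\<close>
  moreover have "B (0, z') (0, z') > 0 \<and> B (s, w') (0, z') = 1
      \<or> - B (0, z') (0, z') > 0 \<and> B (s, w') (0, z') = - 1
      \<or> B (0, z') (0, z') = 0 \<and> B (s, w') (0, z') = 1"
    using sign by linarith
  ultimately show ?thesis
    using pos by (metis add.inverse_inverse)
qed

end
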